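(* Let $G$ be a Lie group, $M$ a differentiable manifold endowed with a metric $d$ inducing the topology of $M$, $X$ a non-empty compact subset of $M$, and $\varphi:G\times M\to M$ a smooth left action by isometries of $(M,d)$. Let $I\subset\mathbb R$ be an interval and let $\gamma:I\to G/H_X$ be continuous with respect to the metric $d_X$. Then $\gamma$ is continuous with respect to the quotient topology $\tau$ of $G/H_X$.
   Context: All differentiable manifolds (including Lie groups) are Hausdorff with countable basis. The action is by isometries if $d(gx,gy)=d(x,y)$ for all $g\in G$, $x,y\in M$. $H_X=\{g\in G:gX=X\}$ is the isotropy subgroup of $X$. The induced Hausdorff metric on $G/H_X$ is $d_X(g_1H_X,g_2H_X)=d_H(g_1X,g_2X)$, where $d_H(A,B)=\max\{\sup_{a\in A}d(a,B),\sup_{b\in B}d(b,A)\}$ is the Hausdorff distance. The topology induced by $d_X$ may be strictly coarser than $\tau$. *)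

theory Defs
  imports "HOL-Analysis.Analysis" "HOL-Algebra.Group_Action" "HOL-Algebra.Left_Coset"
begin

section \<open>Smooth maps between finite-dimensional normed spaces\<close>

text \<open>For an open set \<open>S\<close> in a finite-dimensional space this is \<open>C\<^sup>n\<close> in the usual sense: all iterated
  directional derivatives up to order \<open>n\<close> exist and are continuous.\<close>

primrec Ck_on :: "nat \<Rightarrow> 'a::real_normed_vector set \<Rightarrow> ('a \<Rightarrow> 'b::real_normed_vector) \<Rightarrow> bool" where
  "Ck_on 0 S f \<longleftrightarrow> continuous_on S f"
| "Ck_on (Suc n) S f \<longleftrightarrow>
     (\<forall>x\<in>S. f differentiable (at x)) \<and> (\<forall>v. Ck_on n S (\<lambda>x. frechet_derivative f (at x) v))"

definition smooth_on :: "'a::real_normed_vector set \<Rightarrow> ('a \<Rightarrow> 'b::real_normed_vector) \<Rightarrow> bool" where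
  "smooth_on S f \<longleftrightarrow> (\<forall>n. Ck_on n S f)"

text \<open>Every instance of the class \<open>euclidean_space\<close> has positive dimension. The model space of a
  manifold is therefore a finite-dimensional type of class \<open>real_normed_vector\<close>, and the following
  instance provides the model space of dimension 0 (so that countable discrete groups are Lie
  groups).\<close>

instantiation unit :: real_normed_vector
begin

definition zero_unit :: unit where "zero_unit = ()"
definition plus_unit :: "unit \<Rightarrow> unit \<Rightarrow> unit" where "plus_unit x y = ()"
definition scaleR_unit :: "real \<Rightarrow> unit \<Rightarrow> unit" where "scaleR_unit r x = ()"
definition norm_unit :: "unit \<Rightarrow> real" where "norm_unit x = 0"
definition dist_unit :: "unit \<Rightarrow> unit \<Rightarrow> real" where "dist_unit x y = 0"
definition sgn_unit :: "unit \<Rightarrow> unit" where "sgn_unit x = ()"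
definition uniformity_unit :: "(unit \<times> unit) filter"
  where "uniformity_unit = (INF e\<in>{0 <..}. principal {(x, y). dist x y < e})"
definition open_unit :: "unit set \<Rightarrow> bool"
  where "open_unit U \<longleftrightarrow> (\<forall>x\<in>U. eventually (\<lambda>(x', y). x' = x \<longrightarrow> y \<in> U) uniformity)"

instance
proof
  show "uniformity = (INF e\<in>{0 <..}. principal {(x :: unit, y). dist x y < e})"
    by (rule uniformity_unit_def)
  show "open U \<longleftrightarrow> (\<forall>x\<in>U. \<forall>\<^sub>F (x', y) in uniformity. x' = x \<longrightarrow> y \<in> U)" for U :: "unit set"
    by (rule open_unit_def)
  fix a b c x y :: unit and r s :: real
  have eq: "u = v" for u v :: unit
    by (metis (full_types) old.unit.exhaust)
  show "a + b + c = a + (b + c)" "a + b = b + a" "0 + a = a" "- a + a = 0" "a - b = a + - b"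
    "r *\<^sub>R (x + y) = r *\<^sub>R x + r *\<^sub>R y" "(r + s) *\<^sub>R x = r *\<^sub>R x + s *\<^sub>R x"
    "r *\<^sub>R s *\<^sub>R x = (r * s) *\<^sub>R x" "1 *\<^sub>R x = x" "sgn x = inverse (norm x) *\<^sub>R x"
    by (rule eq)+
  show "dist x y = norm (x - y)" "norm (x + y) \<le> norm x + norm y"
    "norm (r *\<^sub>R x) = \<bar>r\<bar> * norm x"
    by (simp_all only: norm_unit_def dist_unit_def)
  show "norm x = 0 \<longleftrightarrow> x = 0"
    by (rule iffI) (rule eq, rule norm_unit_def)
qed

end

section \<open>Smooth manifolds and Lie groups\<close>

text \<open>A chart is a pair of its domain and a map, whose values outside the domain are irrelevant.\<close>

type_synonym ('a, 'e) chart = "'a set \<times> ('a \<Rightarrow> 'e)"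

definition chart_on :: "'a topology \<Rightarrow> ('a, 'e::real_normed_vector) chart \<Rightarrow> bool" where
  "chart_on T = (\<lambda>(U, c). openin T U \<and> open (c ` U) \<and>
     homeomorphic_map (subtopology T U) (top_of_set (c ` U)) c)"

text \<open>The smooth structure is given by an atlas, not necessarily maximal. Smoothness of maps
  is insensitive to passing to the maximal atlas.\<close>

locale smooth_manifold =
  fixes T :: "'a topology" and A :: "('a, 'e::real_normed_vector) chart set"
  assumes model_finite_dim: "\<exists>B :: 'e set. finite B \<and> span B = UNIV"
    and Hausdorff: "Hausdorff_space T"
    and countable_basis: "second_countable T"
    and charts: "\<And>U c. (U, c) \<in> A \<Longrightarrow> chart_on T (U, c)"
    and covering: "(\<Union>(U, c)\<in>A. U) = topspace T"
    and compatible: "\<And>U c V c'. (U, c) \<in> A \<Longrightarrow> (V, c') \<in> A \<Longrightarrow>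
      smooth_on (c ` (U \<inter> V)) (c' \<circ> inv_into U c)"

definition smooth_map ::
  "'a topology \<Rightarrow> ('a, 'e::real_normed_vector) chart set \<Rightarrow>
   'b topology \<Rightarrow> ('b, 'f::real_normed_vector) chart set \<Rightarrow> ('a \<Rightarrow> 'b) \<Rightarrow> bool" where
  "smooth_map S A T B f \<longleftrightarrow> continuous_map S T f \<and>
     (\<forall>(U, c)\<in>A. \<forall>(V, c')\<in>B. smooth_on (c ` {x \<in> U. f x \<in> V}) (c' \<circ> f \<circ> inv_into U c))"

definition prod_atlas ::
  "('a, 'e) chart set \<Rightarrow> ('b, 'f) chart set \<Rightarrow> ('a \<times> 'b, 'e \<times> 'f) chart set" where
  "prod_atlas A B = (\<lambda>((U, c), (V, c')). (U \<times> V, map_prod c c')) ` (A \<times> B)"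

locale lie_group = group G + smooth_manifold T A
  for G :: "('g, 'r) monoid_scheme" (structure)
    and T :: "'g topology" and A :: "('g, 'e::real_normed_vector) chart set" +
  assumes topspace_eq_carrier: "topspace T = carrier G"
    and smooth_mult: "smooth_map (prod_topology T T) (prod_atlas A A) T A (\<lambda>(g, h). g \<otimes> h)"
    and smooth_inv: "smooth_map T A T A (\<lambda>g. inv g)"

section \<open>The space of left cosets of an isotropy group\<close>

definition quotient_topology :: "'a topology \<Rightarrow> ('a \<Rightarrow> 'b) \<Rightarrow> 'b topology" where
  "quotient_topology T q =
     topology (\<lambda>U. U \<subseteq> q ` topspace T \<and> openin T {x \<in> topspace T. q x \<in> U})"

lemma openin_quotient_topology:
  "openin (quotient_topology T q) U \<longleftrightarrow>
     U \<subseteq> q ` topspace T \<and> openin T {x \<in> topspace T. q x \<in> U}"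
proof -
  have "istopology (\<lambda>U. U \<subseteq> q ` topspace T \<and> openin T {x \<in> topspace T. q x \<in> U})"
    unfolding istopology_def
  proof (intro conjI allI impI)
    fix S S' assume *: "S \<subseteq> q ` topspace T \<and> openin T {x \<in> topspace T. q x \<in> S}"
      "S' \<subseteq> q ` topspace T \<and> openin T {x \<in> topspace T. q x \<in> S'}"
    have "{x \<in> topspace T. q x \<in> S \<inter> S'} = {x \<in> topspace T. q x \<in> S} \<inter> {x \<in> topspace T. q x \<in> S'}"
      by auto
    with * show "S \<inter> S' \<subseteq> q ` topspace T" "openin T {x \<in> topspace T. q x \<in> S \<inter> S'}"
      by auto
  next
    fix K assume *: "\<forall>S\<in>K. S \<subseteq> q ` topspace T \<and> openin T {x \<in> topspace T. q x \<in> S}"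
    have "{x \<in> topspace T. q x \<in> \<Union>K} = (\<Union>S\<in>K. {x \<in> topspace T. q x \<in> S})"
      by auto
    with * show "\<Union>K \<subseteq> q ` topspace T" "openin T {x \<in> topspace T. q x \<in> \<Union>K}"
      by auto
  qed
  then show ?thesis
    by (simp add: quotient_topology_def)
qed

lemma quotient_map_quotient_topology: "quotient_map T (quotient_topology T q) q"
proof -
  have "{x \<in> topspace T. q x \<in> q ` topspace T} = topspace T"
    by auto
  then have "openin (quotient_topology T q) (q ` topspace T)"
    by (simp add: openin_quotient_topology)
  then have "topspace (quotient_topology T q) = q ` topspace T"
    by (metis openin_quotient_topology openin_subset openin_topspace subset_antisym)
  then show ?thesis
    by (auto simp: quotient_map_def openin_quotient_topology)
qed

definition isotropy_subgroup :: "('g, 'r) monoid_scheme \<Rightarrow> ('g \<Rightarrow> 'm \<Rightarrow> 'm) \<Rightarrow> 'm set \<Rightarrow> 'g set" where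
  "isotropy_subgroup G \<phi> X = {g \<in> carrier G. \<phi> g ` X = X}"

text \<open>The suprema and infima are those of the conditionally complete lattice of the reals; they are
  meaningful for non-empty bounded sets.\<close>

definition Hausdorff_dist :: "('m \<Rightarrow> 'm \<Rightarrow> real) \<Rightarrow> 'm set \<Rightarrow> 'm set \<Rightarrow> real" where
  "Hausdorff_dist d A B = max (SUP a\<in>A. INF b\<in>B. d a b) (SUP b\<in>B. INF a\<in>A. d b a)"

text \<open>The value does not depend on the chosen representatives, see
  \<open>coset_dist_l_coset\<close> below. The value 0 outside the coset space only serves to make
  the function non-negative and symmetric everywhere, as the locale \<open>Metric_space\<close> demands.\<close>

definition coset_dist ::
  "('g, 'r) monoid_scheme \<Rightarrow> ('g \<Rightarrow> 'm \<Rightarrow> 'm) \<Rightarrow> ('m \<Rightarrow> 'm \<Rightarrow> real) \<Rightarrow> 'm set \<Rightarrow>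
   'g set \<Rightarrow> 'g set \<Rightarrow> real" where
  "coset_dist G \<phi> d X C D =
     (let H = isotropy_subgroup G \<phi> X;
          rep = (\<lambda>C. SOME g. g \<in> carrier G \<and> C = g <#\<^bsub>G\<^esub> H)
      in if C \<in> lcosets\<^bsub>G\<^esub> H \<and> D \<in> lcosets\<^bsub>G\<^esub> H
         then Hausdorff_dist d (\<phi> (rep C) ` X) (\<phi> (rep D) ` X) else 0)"

lemma (in group_action) isotropy_coset_eq_iff:
  assumes X: "X \<subseteq> E" and g: "g \<in> carrier G" and h: "h \<in> carrier G"
  shows "g <#\<^bsub>G\<^esub> isotropy_subgroup G \<phi> X = h <#\<^bsub>G\<^esub> isotropy_subgroup G \<phi> X
    \<longleftrightarrow> \<phi> g ` X = \<phi> h ` X"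
proof -
  interpret group G
    using group_hom by (simp add: group_hom_def)
  let ?H = "isotropy_subgroup G \<phi> X"
  have comp: "\<phi> (a \<otimes> b) ` X = \<phi> a ` \<phi> b ` X" if "a \<in> carrier G" "b \<in> carrier G" for a b
    using that X composition_rule by (force simp: image_image)
  have one: "\<phi> \<one> ` X = X"
  proof -
    have "\<phi> \<one> ` X = (\<lambda>x. x) ` X"
      using X by (intro image_cong) (auto simp flip: id_eq_one)
    then show ?thesis by simp
  qed
  have coset: "a <# ?H = {k \<in> carrier G. \<phi> k ` X = \<phi> a ` X}" if a: "a \<in> carrier G" for a
  proof (intro subset_antisym subsetI)
    fix k assume "k \<in> a <# ?H"
    then obtain h where "h \<in> carrier G" "\<phi> h ` X = X" "k = a \<otimes> h"
      by (auto simp: l_coset_def isotropy_subgroup_def)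
    with a comp[of a h] show "k \<in> {k \<in> carrier G. \<phi> k ` X = \<phi> a ` X}"
      by simp
  next
    fix k assume k: "k \<in> {k \<in> carrier G. \<phi> k ` X = \<phi> a ` X}"
    then have "\<phi> (inv a \<otimes> k) ` X = X"
      using a one comp[of "inv a" k] comp[of "inv a" a] by simp
    moreover have "k = a \<otimes> (inv a \<otimes> k)"
      using a k by (simp flip: m_assoc)
    ultimately show "k \<in> a <# ?H"
      using a k unfolding l_coset_def isotropy_subgroup_def by blast
  qed
  show ?thesis
  proof
    assume "g <# ?H = h <# ?H"
    then have "{k \<in> carrier G. \<phi> k ` X = \<phi> g ` X} = {k \<in> carrier G. \<phi> k ` X = \<phi> h ` X}"
      by (simp only: coset[OF g] coset[OF h])
    moreover have "g \<in> {k \<in> carrier G. \<phi> k ` X = \<phi> g ` X}"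
      using g by simp
    ultimately have "g \<in> {k \<in> carrier G. \<phi> k ` X = \<phi> h ` X}"
      by (rule subst)
    then show "\<phi> g ` X = \<phi> h ` X"
      unfolding mem_Collect_eq by (rule conjunct2)
  next
    assume "\<phi> g ` X = \<phi> h ` X"
    then show "g <# ?H = h <# ?H"
      by (simp only: coset[OF g] coset[OF h])
  qed
qed

lemma coset_dist_l_coset:
  assumes act: "group_action G E \<phi>" and X: "X \<subseteq> E" and g: "g \<in> carrier G" and h: "h \<in> carrier G"
  defines "H \<equiv> isotropy_subgroup G \<phi> X"
  shows "coset_dist G \<phi> d X (g <#\<^bsub>G\<^esub> H) (h <#\<^bsub>G\<^esub> H) = Hausdorff_dist d (\<phi> g ` X) (\<phi> h ` X)"
proof -
  interpret group_action G E \<phi> by fact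
  have rep: "\<phi> (SOME g'. g' \<in> carrier G \<and> k <#\<^bsub>G\<^esub> H = g' <#\<^bsub>G\<^esub> H) ` X = \<phi> k ` X"
    if k: "k \<in> carrier G" for k
  proof (rule someI2 [where a = k])
    fix g' assume g': "g' \<in> carrier G \<and> k <#\<^bsub>G\<^esub> H = g' <#\<^bsub>G\<^esub> H"
    then have "\<phi> k ` X = \<phi> g' ` X"
      using isotropy_coset_eq_iff[OF X k, of g'] unfolding H_def by blast
    then show "\<phi> g' ` X = \<phi> k ` X" by simp
  qed (use k in simp)
  have "k <#\<^bsub>G\<^esub> H \<in> lcosets\<^bsub>G\<^esub> H" if "k \<in> carrier G" for k
    using that by (auto simp: LCOSETS_def)
  then show ?thesis
    unfolding coset_dist_def Let_def H_def[symmetric] using g h rep by simp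
qed

lemma Hausdorff_dist_commute: "Hausdorff_dist d A B = Hausdorff_dist d B A"
  by (simp add: Hausdorff_dist_def max.commute)

context Metric_space
begin

lemma Hausdorff_dist_aux:
  assumes A: "compactin mtopology A" "A \<noteq> {}" and B: "compactin mtopology B" "B \<noteq> {}"
  shows "bdd_below (d a ` B)" "bdd_above ((\<lambda>a. INF b\<in>B. d a b) ` A)"
    and "a \<in> A \<Longrightarrow> (INF b\<in>B. d a b) \<le> Hausdorff_dist d A B"
proof -
  show bb: "bdd_below (d a ` B)" for a
    by (rule bdd_belowI[of _ 0]) auto
  have "A \<subseteq> M" "B \<subseteq> M"
    using A B compactin_subset_topspace by fastforce+
  obtain b where b: "b \<in> B" using B by auto
  have "mbounded A"
    using A compactin_imp_mbounded by blast
  then obtain c r where "A \<subseteq> mcball c r"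
    by (auto simp: mbounded_def)
  then have "(INF b\<in>B. d a b) \<le> r + d c b" if "a \<in> A" for a
    using that b \<open>A \<subseteq> M\<close> \<open>B \<subseteq> M\<close> cINF_lower[OF bb b, of a] triangle[of a c b] commute[of a c]
    by (fastforce simp: subset_iff)
  then show ba: "bdd_above ((\<lambda>a. INF b\<in>B. d a b) ` A)"
    by (intro bdd_aboveI2[of _ _ "r + d c b"])
  show "(INF b\<in>B. d a b) \<le> Hausdorff_dist d A B" if "a \<in> A"
    using cSUP_upper[OF that ba] by (simp add: Hausdorff_dist_def)
qed

lemma Hausdorff_dist_nonneg:
  assumes "compactin mtopology A" "A \<noteq> {}" "compactin mtopology B" "B \<noteq> {}"
  shows "0 \<le> Hausdorff_dist d A B"
proof -
  obtain a where a: "a \<in> A" using assms by auto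
  have "0 \<le> (INF b\<in>B. d a b)"
    using assms by (intro cINF_greatest) auto
  then show ?thesis
    using Hausdorff_dist_aux(3)[OF assms a] by simp
qed

lemma Hausdorff_dist_le:
  assumes "A \<noteq> {}" "B \<noteq> {}"
    and "\<And>a. a \<in> A \<Longrightarrow> (INF b\<in>B. d a b) \<le> r" "\<And>b. b \<in> B \<Longrightarrow> (INF a\<in>A. d b a) \<le> r"
  shows "Hausdorff_dist d A B \<le> r"
  unfolding Hausdorff_dist_def using assms by (auto intro!: cSUP_least)

lemma Hausdorff_dist_near:
  assumes "compactin mtopology A" "A \<noteq> {}" "compactin mtopology B" "B \<noteq> {}" "a \<in> A" "0 < e"
  obtains b where "b \<in> B" "d a b < Hausdorff_dist d A B + e"
proof -
  have "(INF b\<in>B. d a b) < Hausdorff_dist d A B + e"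
    using Hausdorff_dist_aux(3)[OF assms(1-5)] \<open>0 < e\<close> by linarith
  then show ?thesis
    using that assms cINF_less_iff[OF assms(4) Hausdorff_dist_aux(1)[OF assms(1-4)]] by blast
qed

lemma Hausdorff_dist_zero_subset:
  assumes "compactin mtopology A" "A \<noteq> {}" "compactin mtopology B" "B \<noteq> {}"
    and 0: "Hausdorff_dist d A B = 0"
  shows "A \<subseteq> B"
proof
  fix a assume a: "a \<in> A"
  have "A \<subseteq> M" 
    using assms compactin_subset_topspace by fastforce
  have "closedin mtopology B"
    using assms compactin_imp_closedin Hausdorff_space_mtopology by blast
  moreover have "\<exists>b\<in>B. d a b < e" if "e > 0" for e
    using Hausdorff_dist_near[OF assms(1-4) a that] 0 by auto
  moreover have "a \<in> M" "B \<subseteq> M"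
    using a \<open>A \<subseteq> M\<close> assms compactin_subset_topspace by fastforce+
  ultimately show "a \<in> B"
    unfolding closedin_metric disjnt_iff in_mball by blast
qed

lemma Hausdorff_dist_triangle:
  assumes A: "compactin mtopology A" "A \<noteq> {}" and B: "compactin mtopology B" "B \<noteq> {}"
    and C: "compactin mtopology C" "C \<noteq> {}"
  shows "Hausdorff_dist d A C \<le> Hausdorff_dist d A B + Hausdorff_dist d B C"
proof -
  have main: "(INF c\<in>C. d a c) \<le> Hausdorff_dist d A B + Hausdorff_dist d B C"
    if A: "compactin mtopology A" "A \<noteq> {}" and B: "compactin mtopology B" "B \<noteq> {}"
    and C: "compactin mtopology C" "C \<noteq> {}" and a: "a \<in> A" for A B C a
  proof (rule field_le_epsilon)
    fix e :: real assume "e > 0"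
    then have e: "e/2 > 0" by simp
    obtain b where b: "b \<in> B" "d a b < Hausdorff_dist d A B + e/2"
      by (rule Hausdorff_dist_near[OF A B a e])
    obtain c where c: "c \<in> C" "d b c < Hausdorff_dist d B C + e/2"
      by (rule Hausdorff_dist_near[OF B C b(1) e])
    have "a \<in> M" "b \<in> M" "c \<in> M"
      using A B C a b c compactin_subset_topspace by fastforce+
    then have "d a c \<le> d a b + d b c"
      by (rule triangle)
    moreover have "(INF c\<in>C. d a c) \<le> d a c"
      by (rule cINF_lower[OF Hausdorff_dist_aux(1)[OF A C] c(1)])
    ultimately show "(INF c\<in>C. d a c) \<le> Hausdorff_dist d A B + Hausdorff_dist d B C + e"
      using b c by linarith
  qed
  show ?thesis
    using main[OF A B C] main[OF C B A] A C
    by (intro Hausdorff_dist_le)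
      (auto simp: Hausdorff_dist_commute[of d C B] Hausdorff_dist_commute[of d B A] add.commute)
qed

end

lemma Metric_space_coset_dist:
  assumes act: "group_action G M \<phi>" and "Metric_space M d"
    and X: "X \<noteq> {}" "compactin (Metric_space.mtopology M d) X"
    and iso: "\<And>g x y. g \<in> carrier G \<Longrightarrow> x \<in> M \<Longrightarrow> y \<in> M \<Longrightarrow> d (\<phi> g x) (\<phi> g y) = d x y"
  shows "Metric_space (lcosets\<^bsub>G\<^esub> isotropy_subgroup G \<phi> X) (coset_dist G \<phi> d X)"
proof -
  interpret Metric_space M d by fact
  interpret group_action G M \<phi> by fact
  let ?H = "isotropy_subgroup G \<phi> X" and ?d = "coset_dist G \<phi> d X"
  have XM: "X \<subseteq> M"
    using X compactin_subset_topspace by fastforce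
  have cpt: "compactin mtopology (\<phi> g ` X)" "\<phi> g ` X \<noteq> {}" if g: "g \<in> carrier G" for g
  proof -
    have "continuous_map mtopology mtopology (\<phi> g)"
    proof -
      have "\<phi> g \<in> M \<rightarrow> M"
        using element_image[OF g] by auto
      then show ?thesis
        using iso[OF g] by (auto simp: metric_continuous_map[OF Metric_space_axioms] Pi_iff)
    qed
    then show "compactin mtopology (\<phi> g ` X)"
      using X image_compactin by blast
  qed (use X in auto)
  have coset: "C \<in> lcosets\<^bsub>G\<^esub> ?H \<longleftrightarrow> (\<exists>g\<in>carrier G. C = g <#\<^bsub>G\<^esub> ?H)" for C
    by (auto simp: LCOSETS_def)
  note val = coset_dist_l_coset[OF act XM]
  show ?thesis
  proof
    fix C D
    show "0 \<le> ?d C D" 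
    proof (cases "C \<in> lcosets\<^bsub>G\<^esub> ?H \<and> D \<in> lcosets\<^bsub>G\<^esub> ?H")
      case True
      then show ?thesis
        using Hausdorff_dist_nonneg cpt by (auto simp: coset val)
    next
      case False
      then show ?thesis by (auto simp: coset_dist_def Let_def)
    qed
    show "?d C D = ?d D C"
      by (auto simp: coset_dist_def Let_def Hausdorff_dist_commute)
  next
    fix C D assume "C \<in> lcosets\<^bsub>G\<^esub> ?H" "D \<in> lcosets\<^bsub>G\<^esub> ?H"
    then obtain g h where gh: "g \<in> carrier G" "C = g <#\<^bsub>G\<^esub> ?H" "h \<in> carrier G" "D = h <#\<^bsub>G\<^esub> ?H"
      by (auto simp: coset)
    have "Hausdorff_dist d (\<phi> g ` X) (\<phi> h ` X) = 0 \<longleftrightarrow> \<phi> g ` X = \<phi> h ` X" (is "?l \<longleftrightarrow> ?r")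
    proof
      assume ?l
      then show ?r
        using gh Hausdorff_dist_zero_subset[OF cpt cpt] Hausdorff_dist_commute
        by (metis subset_antisym)
    next
      assume ?r
      have "Hausdorff_dist d (\<phi> g ` X) (\<phi> g ` X) \<le> 0"
      proof (rule Hausdorff_dist_le)
        fix a assume a: "a \<in> \<phi> g ` X"
        have "a \<in> M" using a cpt(1)[OF gh(1)] compactin_subset_topspace by fastforce
        then show "(INF b\<in>\<phi> g ` X. d a b) \<le> 0"
          using cINF_lower[OF Hausdorff_dist_aux(1)[OF cpt[OF gh(1)] cpt[OF gh(1)]] a, of a]
          by simp
        then show "(INF b\<in>\<phi> g ` X. d a b) \<le> 0" .
      qed (use X in auto)
      then show ?l
        using \<open>?r\<close> Hausdorff_dist_nonneg[OF cpt cpt] gh by (metis order_antisym)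
    qed
    then show "?d C D = 0 \<longleftrightarrow> C = D"
      using gh isotropy_coset_eq_iff[OF XM] by (simp add: val)
  next
    fix C D K assume "C \<in> lcosets\<^bsub>G\<^esub> ?H" "D \<in> lcosets\<^bsub>G\<^esub> ?H" "K \<in> lcosets\<^bsub>G\<^esub> ?H"
    then show "?d C K \<le> ?d C D + ?d D K"
      using Hausdorff_dist_triangle cpt by (auto simp: coset val)
  qed
qed

end

theory Submission
  imports Defs
begin

text \<open>
  Around the base point \<open>H\<close> of \<open>G/H\<close> choose a \<open>\<tau>\<close>-open set \<open>U\<close> and a \<open>\<tau>\<close>-compact set \<open>K\<close> containing it. Since
  \<open>\<tau>\<close> is finer than the Hausdorff topology of \<open>d\<^sub>X\<close>, the shell \<open>K - U\<close> is \<open>d\<^sub>X\<close>-closed and therefore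
  has some distance \<open>\<delta> > 0\<close> from \<open>H\<close>; as \<open>G\<close> acts transitively by isometries, the same \<open>\<delta>\<close> works at
  every point. Hence the \<open>\<tau>\<close>-components of a \<open>d\<^sub>X\<close>-ball of radius \<open>\<delta>/2\<close> meet the concentric closed ball
  of radius \<open>\<delta>/4\<close> in \<open>\<tau>\<close>-compact, thus \<open>d\<^sub>X\<close>-closed, sets. There are countably many of them, because
  \<open>\<tau>\<close> is locally connected and separable. By Sierpinski's theorem an interval is not a countable
  disjoint union of two or more nonempty closed sets, so locally \<open>\<gamma>\<close> stays in one such compact set,
  where \<open>\<tau>\<close> and the topology of \<open>d\<^sub>X\<close> agree.
\<close>

section \<open>Closed balls in the model space and neighbourhoods in a manifold\<close>

text \<open>Heine-Borel for a normed space known only to have a finite spanning set. In coordinates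
  over a basis \<open>C\<close>, the faces of the unit cube have a compact image that misses 0.
  Hence the image of the whole cube contains a ball around 0, and a scaled and translated copy of
  this compact image covers any given closed ball.\<close>

lemma compact_cball_if_finite_span:
  fixes B :: "'a::real_normed_vector set"
  assumes "finite B" "span B = UNIV"
  shows "compact (cball (x::'a) r)"
proof -
  obtain C where "C \<subseteq> B" and indep: "independent C" and "B \<subseteq> span C"
    using maximal_independent_subset[of B] by blast
  have C: "finite C" "span C = UNIV"
    using \<open>C \<subseteq> B\<close> \<open>finite B\<close> finite_subset \<open>B \<subseteq> span C\<close> \<open>span B = UNIV\<close> span_mono[of B "span C"]
    by (auto simp: span_span)
  define f where "f = (\<lambda>u::'a \<Rightarrow> real. \<Sum>b\<in>C. u b *\<^sub>R b)"
  \<comment> \<open>The cube lives in the full function space, so that it is compact by Tychonoff;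
    coordinates outside \<open>C\<close> are ignored by \<open>f\<close>.\<close>
  define Q where "Q = Pi\<^sub>E UNIV (\<lambda>b::'a. {-1..1::real})"
  define S where "S = Q \<inter> (\<Union>b\<in>C. {u. \<bar>u b\<bar> = 1})"
  have contf: "continuous_on A f" for A
    unfolding f_def by (intro continuous_intros continuous_on_product_then_coordinatewise continuous_on_id)
  have "compactin (product_topology (\<lambda>b::'a. euclideanreal) UNIV) Q"
    unfolding Q_def by (subst compactin_PiE) auto
  then have "compact Q"
    by (simp add: euclidean_product_topology)
  moreover have "closed (\<Union>b\<in>C. {u::'a \<Rightarrow> real. \<bar>u b\<bar> = 1})"
    by (intro closed_UN C(1) ballI closed_Collect_eq continuous_intros
        continuous_on_product_then_coordinatewise continuous_on_id)
  ultimately have "compact S"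
    unfolding S_def by (rule compact_Int_closed)
  then have "closed (f ` S)"
    by (intro compact_imp_closed compact_continuous_image contf)
  \<comment> \<open>A point of \<open>S\<close> has a coordinate of absolute value 1 at some element
    of \<open>C\<close>, so independence of \<open>C\<close> excludes the value 0.\<close>
  moreover have "0 \<notin> f ` S"
    using independentD[OF indep C(1) order_refl] by (force simp: f_def S_def) 
  ultimately obtain m where m: "m > 0" "ball 0 m \<subseteq> - f ` S"
    by (metis ComplI open_Compl open_contains_ball)
  have small: "v \<in> f ` Q" if v: "v \<in> ball 0 m" for v
  proof -
    have "v \<in> span C" using C by simp
    then obtain u where u: "v = f u"
      unfolding span_finite[OF C(1)] f_def by blast
    \<comment> \<open>Inserting 0 keeps the maximum meaningful when \<open>C\<close> is empty, that
      is, in dimension 0.\<close>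
    define N where "N = Max (insert 0 ((\<lambda>b. \<bar>u b\<bar>) ` C))"
    have N: "\<bar>u b\<bar> \<le> N" if "b \<in> C" for b
      using that C(1) by (simp add: N_def)
    define w where "w = (\<lambda>k b. if b \<in> C then k * u b else 0)"
    have fw: "f (w k) = k *\<^sub>R v" for k
      by (simp add: u f_def w_def scaleR_sum_right)
    \<comment> \<open>Otherwise division by \<open>N\<close> moves the coefficients onto a face of
      the cube, while the vector only becomes shorter and stays in the ball that avoids the image of
      \<open>S\<close>.\<close>
    have "N \<le> 1"
    proof (rule ccontr)
      assume N1: "\<not> N \<le> 1"
      have "N \<in> insert 0 ((\<lambda>b. \<bar>u b\<bar>) ` C)"
        unfolding N_def by (rule Max_in) (use C in auto)
      then obtain b where b: "b \<in> C" "N = \<bar>u b\<bar>" using N1 by auto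
      have "w (1/N) \<in> Q"
        using N N1 by (auto simp: Q_def w_def abs_le_iff divide_le_eq le_divide_eq minus_le_iff)
      then have "w (1/N) \<in> S"
        using b N1 by (auto simp: S_def w_def)
      moreover have "f (w (1/N)) \<in> ball 0 m"
      proof -
        have "norm v / N \<le> norm v" using N1 mult_left_mono[of 1 N "norm v"] by (simp add: divide_le_eq)
        then show ?thesis using v N1 by (simp add: fw)
      qed
      ultimately show False using m by blast
    qed
    then have "w 1 \<in> Q"
      using N by (fastforce simp: Q_def w_def abs_le_iff)
    then show ?thesis
      by (metis fw scaleR_one image_eqI)
  qed
  \<comment> \<open>With this factor \<open>k * m\<close> is \<open>\<bar>r\<bar> + 1\<close>, which
    exceeds \<open>r\<close>; the absolute value keeps \<open>k\<close> positive for negative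
    \<open>r\<close>.\<close>
  define k where "k = (\<bar>r\<bar> + 1) / m"
  have k: "k > 0" using m by (simp add: k_def)
  have "cball x r \<subseteq> (\<lambda>v. x + v) ` (\<lambda>v. k *\<^sub>R v) ` f ` Q"
  proof
    fix y assume y: "y \<in> cball x r"
    have "norm (y - x) < k * m"
      using y m by (auto simp: k_def dist_norm norm_minus_commute)
    then have "(1/k) *\<^sub>R (y - x) \<in> f ` Q"
      using k by (intro small) (simp add: divide_less_eq mult.commute flip: scaleR_diff_right)
    moreover have "y = x + k *\<^sub>R ((1/k) *\<^sub>R (y - x))"
      using k by simp
    ultimately show "y \<in> (\<lambda>v. x + v) ` (\<lambda>v. k *\<^sub>R v) ` f ` Q"
      by blast
  qed
  moreover have "compact ((\<lambda>v. x + v) ` (\<lambda>v. k *\<^sub>R v) ` f ` Q)"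
    by (intro compact_translation compact_scaling compact_continuous_image contf \<open>compact Q\<close>)
  ultimately show ?thesis
    by (metis closed_cball compact_Int_closed inf.absorb_iff2)
qed

text \<open>\<open>W\<close> and \<open>K\<close> are an open and a closed ball in the image of a
  chart, carried back by its inverse: the former is connected by convexity, the latter compact by
  Heine-Borel. \<open>W\<close> serves local connectedness, \<open>K\<close> local
  compactness.\<close>

lemma (in smooth_manifold) compact_connected_neighbourhood:
  assumes "openin T V" "x \<in> V"
  obtains W K where "openin T W" "connectedin T W" "compactin T K" "x \<in> W" "W \<subseteq> K" "K \<subseteq> V"
proof -
  have "x \<in> topspace T"
    using assms openin_subset by blast
  then obtain U c where Uc: "(U, c) \<in> A" "x \<in> U"
    using covering by fastforce
  have U: "openin T U" "open (c ` U)" and hom: "homeomorphic_map (subtopology T U) (top_of_set (c ` U)) c"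
    using charts[OF Uc(1)] by (auto simp: chart_on_def)
  then obtain g where "homeomorphic_maps (subtopology T U) (top_of_set (c ` U)) c g"
    unfolding homeomorphic_map_maps by blast
  then have g: "homeomorphic_map (top_of_set (c ` U)) (subtopology T U) g"
    and gc: "\<And>y. y \<in> U \<Longrightarrow> g (c y) = y"
    using openin_subset[OF U(1)]
    by (auto simp: homeomorphic_maps_map Int_absorb1)
  have "openin (subtopology T U) (U \<inter> V)"
    using assms by (simp add: openin_subtopology_Int2)
  then have "openin (top_of_set (c ` U)) (c ` (U \<inter> V))"
    using hom homeomorphic_imp_open_map open_map_def by blast
  then have "open (c ` (U \<inter> V))"
    using U openin_open_eq by blast
  moreover have "c x \<in> c ` (U \<inter> V)"
    using Uc assms by blast
  ultimately obtain r where r: "r > 0" "cball (c x) r \<subseteq> c ` (U \<inter> V)"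
    by (meson open_contains_cball)
  have cont: "continuous_map (top_of_set (c ` U)) T g"
    using g homeomorphic_imp_continuous_map continuous_map_in_subtopology by blast
  have rU: "cball (c x) r \<subseteq> c ` U" "ball (c x) r \<subseteq> c ` U"
    using r(2) ball_subset_cball[of "c x" r] by (blast, blast)
  show ?thesis
  proof
    have "openin (top_of_set (c ` U)) (ball (c x) r)"
      using rU by (simp add: openin_open_eq U)
    then have "openin (subtopology T U) (g ` ball (c x) r)"
      using g homeomorphic_imp_open_map open_map_def by blast
    then show "openin T (g ` ball (c x) r)"
      using U openin_open_subtopology by blast
    have "connectedin (top_of_set (c ` U)) (ball (c x) r)"
      using rU by (simp add: connectedin_subtopology)
    then show "connectedin T (g ` ball (c x) r)"
      using cont connectedin_continuous_map_image by blast
    obtain B :: "'e set" where "finite B" "span B = UNIV"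
      using model_finite_dim by blast
    then have "compactin (top_of_set (c ` U)) (cball (c x) r)"
      using rU by (simp add: compactin_subtopology compact_cball_if_finite_span)
    then show "compactin T (g ` cball (c x) r)"
      using cont image_compactin by blast
    show "x \<in> g ` ball (c x) r"
      using gc[OF Uc(2)] r(1) by (metis centre_in_ball image_eqI)
    show "g ` ball (c x) r \<subseteq> g ` cball (c x) r"
      by (intro image_mono ball_subset_cball)
    show "g ` cball (c x) r \<subseteq> V"
    proof
      fix y assume "y \<in> g ` cball (c x) r"
      then obtain z where "z \<in> U \<inter> V" "y = g (c z)"
        using r by blast
      then show "y \<in> V" using gc by auto
    qed
  qed
qed

lemma (in smooth_manifold) locally_connected: "locally_connected_space T"
  unfolding locally_connected_space
  by (meson compact_connected_neighbourhood order_trans)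


section \<open>Curves in a metric space with a second, finer topology\<close>

lemma (in Metric_space) finer_Hausdorff:
  assumes "topspace T = M" and "\<And>U. openin mtopology U \<Longrightarrow> openin T U"
  shows "Hausdorff_space T"
  using Hausdorff_space_mtopology assms unfolding Hausdorff_space_def topspace_mtopology by meson

text \<open>The identity from \<open>T\<close> to the metric topology is continuous, and compact
  sets in the Hausdorff space \<open>mtopology\<close> are closed. This is the way back from the
  finer topology to the metric one.\<close>

lemma (in Metric_space) finer_compactin_imp_closedin:
  assumes top: "topspace T = M" and finer: "\<And>U. openin mtopology U \<Longrightarrow> openin T U"
    and K: "compactin T K"
  shows "closedin mtopology K"
proof -
  have "continuous_map T mtopology id"
    using finer openin_subset[of mtopology]
    by (auto simp: continuous_map_def top Collect_conj_eq Int_absorb1 Int_absorb2)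
  then have "compactin mtopology K"
    using image_compactin[OF K, of mtopology id] by simp
  then show ?thesis
    using compactin_imp_closedin Hausdorff_space_mtopology by blast
qed

text \<open>The core argument, freed from groups. The inclusion in \<open>nbhd\<close> says that the
  shell \<open>K - U\<close> keeps distance at least \<delta> from \<open>y\<close>. That one
  \<delta> serves all points is essential: the neighbourhoods are applied to points of components
  far from the centre of the ball in the topology \<open>T\<close>.\<close>

lemma (in Metric_space) continuous_map_interval_finer_topology:
  fixes \<gamma> :: "real \<Rightarrow> 'a"
  assumes top: "topspace T = M" and finer: "\<And>U. openin mtopology U \<Longrightarrow> openin T U"
    and lc: "locally_connected_space T" and sep: "separable_space T"
    and "\<delta> > 0"
    and nbhd: "\<And>y. y \<in> M \<Longrightarrow> \<exists>U K. openin T U \<and> compactin T K \<and> y \<in> U \<and> U \<subseteq> K \<and> mball y \<delta> \<inter> K \<subseteq> U"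
    and I: "is_interval I" and cont: "continuous_map (top_of_set I) mtopology \<gamma>"
  shows "continuous_map (top_of_set I) T \<gamma>"
proof -
  have finer_closed: "closedin T C" if "closedin mtopology C" for C
    using that finer by (simp add: closedin_def top)
  have haus: "Hausdorff_space T"
    using top finer by (rule finer_Hausdorff)
  have cpt_closed: "closedin mtopology K" if "compactin T K" for K
    using top finer that by (rule finer_compactin_imp_closedin)
  have \<gamma>M: "\<gamma> t \<in> M" if "t \<in> I" for t
    using continuous_map_image_subset_topspace[OF cont] that by auto
  have local: "\<exists>W. openin (top_of_set I) W \<and> t \<in> W \<and> W \<subseteq> {s \<in> I. \<gamma> s \<in> V}"
    if V: "openin T V" and t: "t \<in> I" "\<gamma> t \<in> V" for t V
  proof -
    define x where "x = \<gamma> t"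
    \<comment> \<open>Two points of \<open>B\<close> are less than \<delta> apart, so the ball of
      radius \<delta> around any point of \<open>B\<close> contains \<open>B\<close>.\<close>
    define B where "B = mball x (\<delta>/2)"
    define P where "P = mcball x (\<delta>/4)"
    define C where "C = (\<lambda>y. connected_component_of_set (subtopology T B) y)"
    have x: "x \<in> M" using \<gamma>M t by (simp add: x_def)
    have opB: "openin T B"
      by (simp add: B_def finer)
    then have topB: "topspace (subtopology T B) = B"
      using openin_subset by fastforce
    have xP: "x \<in> P" and PB: "P \<subseteq> B"
      using x \<open>\<delta> > 0\<close> by (auto simp: P_def B_def)
    have C_subset: "C y \<subseteq> B" for y
      unfolding C_def using connected_component_of_subset_topspace topB by metis
    have C_refl: "y \<in> C y" if "y \<in> B" for y
      using that topB by (simp only: C_def connected_component_of_refl mem_Collect_eq)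
    have C_eq: "C z = C y" if "z \<in> C y" for y z
      using that unfolding C_def
      by (metis connected_component_of_equiv mem_Collect_eq)
    have C_conn: "connectedin T (C y)" for y
      using connectedin_connected_component_of[of "subtopology T B" y]
      by (simp add: C_def connectedin_subtopology)
    have C_open: "openin T (C y)" for y
      unfolding C_def
      by (rule openin_trans_full[OF openin_connected_component_of_locally_connected_space opB])
        (rule locally_connected_space_open_subset[OF lc opB])
    \<comment> \<open>\<open>C y\<close> has diameter at most \<open>\<delta>\<close>, so it cannot cross the shell \<open>K - U\<close> around any of its
      points.\<close>
    have CP_compact: "compactin T (C y \<inter> P)" for y
    proof (cases "C y \<inter> P = {}")
      case False
      then obtain z where z: "z \<in> C y" "z \<in> B" "z \<in> M"
        using C_subset x by (fastforce simp: B_def)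
      obtain U K where UK: "openin T U" "compactin T K" "z \<in> U" "U \<subseteq> K" "mball z \<delta> \<inter> K \<subseteq> U"
        using nbhd z by metis
      have clK: "closedin T K"
        using UK haus compactin_imp_closedin by blast
      have "C y \<subseteq> mball z \<delta>"
      proof
        fix w assume "w \<in> C y"
        then have "w \<in> B" using C_subset by blast
        then show "w \<in> mball z \<delta>"
          using z triangle[of z x w] commute[of z x] x by (auto simp: B_def)
      qed
      then have "C y \<inter> K \<subseteq> U"
        using UK by blast
      moreover have "C y \<subseteq> topspace T"
        using C_open openin_subset by blast
      ultimately have "C y \<subseteq> U \<union> (topspace T - K)" "U \<inter> (topspace T - K) \<inter> C y = {}"
        using UK by auto
      then have "(topspace T - K) \<inter> C y = {}"
        using connectedinD[OF C_conn UK(1), of "topspace T - K" y] clK UK(3) z(1) by blast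
      then have "C y \<subseteq> K"
        using C_open openin_subset by blast
      moreover have "closedin T (C y \<inter> P)"
      proof -
        \<comment> \<open>A component is closed only relative to \<open>B\<close>. Intersecting it
          with the smaller set \<open>P\<close>, which is closed for the metric and hence for
          \<open>T\<close>, gives a set closed in the whole space.\<close>
        have "closedin (subtopology T B) (C y)"
          by (simp add: C_def closedin_connected_component_of)
        then obtain F where F: "closedin T F" "C y = F \<inter> B"
          by (auto simp: closedin_subtopology)
        then have "C y \<inter> P = F \<inter> P" using PB by auto
        then show ?thesis
          using F finer_closed[of P] by (simp add: P_def closedin_Int)
      qed
      ultimately show ?thesis
        using closed_compactin UK(2) by blast
    qed auto
    have countable: "countable (C ` B)"
    proof -
      obtain D where D: "countable D" "D \<subseteq> topspace T" "T closure_of D = topspace T"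
        using sep unfolding separable_space_def by blast
      \<comment> \<open>Every component of \<open>B\<close> is nonempty and open in
        \<open>T\<close>, so it meets the dense set \<open>D\<close>. Points of \<open>D\<close>
        outside \<open>B\<close> contribute at most the empty set.\<close>
      have "C ` B \<subseteq> C ` D"
      proof clarify
        fix y assume y: "y \<in> B"
        then have "C y \<inter> D \<noteq> {}"
          using D(3) C_open[of y] C_refl[OF y] unfolding dense_intersects_open by blast
        then show "C y \<in> C ` D"
          using C_eq by blast
      qed
      then show ?thesis
        using D(1) by (meson countable_image countable_subset)
    qed
    have "openin (top_of_set I) {s \<in> I. \<gamma> s \<in> mball x (\<delta>/4)}"
      using openin_continuous_map_preimage[OF cont openin_mball] by (simp only: topspace_euclidean_subtopology)
    moreover have "t \<in> {s \<in> I. \<gamma> s \<in> mball x (\<delta>/4)}"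
      using t x \<open>\<delta> > 0\<close> by (simp add: x_def)
    ultimately obtain e where e: "e > 0" "ball t e \<inter> I \<subseteq> {s \<in> I. \<gamma> s \<in> mball x (\<delta>/4)}"
      unfolding openin_contains_ball by blast
    have stay: "\<gamma> s \<in> C x \<inter> P" if s: "s \<in> ball t e \<inter> I" for s
    proof -
      define a where "a = min s t"
      define b where "b = max s t"
      have ab: "a \<le> b" "s \<in> {a..b}" "t \<in> {a..b}" by (auto simp: a_def b_def)
      have abI: "{a..b} \<subseteq> ball t e \<inter> I"
      proof
        fix u assume "u \<in> {a..b}"
        then have u: "s \<le> u \<and> u \<le> t \<or> t \<le> u \<and> u \<le> s"
          by (auto simp: a_def b_def min_def max_def split: if_splits)
        then have "u \<in> I"
          using I s t(1) unfolding is_interval_1 by blast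
        then show "u \<in> ball t e \<inter> I"
          using u s by (auto simp: dist_real_def)
      qed
      have P: "\<gamma> u \<in> P" if "u \<in> {a..b}" for u
        using that abI e by (force simp: P_def)
      \<comment> \<open>The segment between \<open>s\<close> and \<open>t\<close> is cut into the
        preimages of the sets \<open>C y \<inter> P\<close>. These are closed because \<gamma> is
        continuous for the metric and these sets are metrically closed; empty pieces are removed, as
        Sierpinski's theorem requires.\<close>
      define \<U> where "\<U> = (\<lambda>Q. {u \<in> {a..b}. \<gamma> u \<in> Q \<inter> P}) ` C ` B - {{}}"
      have "\<U> = {{a..b}}"
      proof (rule real_Sierpinski_lemma[OF ab(1)])
        show "countable \<U>"
          using countable by (simp add: \<U>_def)
        show "disjoint \<U>"
        proof (clarsimp simp: \<U>_def pairwise_def disjnt_iff)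
          fix y z u
          assume "\<gamma> u \<in> C y" "\<gamma> u \<in> C z"
            and ne: "{u. a \<le> u \<and> u \<le> b \<and> \<gamma> u \<in> C y \<and> \<gamma> u \<in> P} \<noteq> {u. a \<le> u \<and> u \<le> b \<and> \<gamma> u \<in> C z \<and> \<gamma> u \<in> P}"
          then have "C y = C z" using C_eq by metis
          with ne show False by simp
        qed
        show "\<Union>\<U> = {a..b}"
        proof (intro equalityI subsetI)
          fix u assume u: "u \<in> {a..b}"
          then have "u \<in> {v \<in> {a..b}. \<gamma> v \<in> C (\<gamma> u) \<inter> P}"
            using P PB C_refl by blast
          moreover from this have "{v \<in> {a..b}. \<gamma> v \<in> C (\<gamma> u) \<inter> P} \<in> \<U>"
            using P PB u unfolding \<U>_def by blast
          ultimately show "u \<in> \<Union>\<U>" by blast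
        qed (auto simp: \<U>_def)
        fix Q assume "Q \<in> \<U>"
        then obtain y where Q: "Q = {u \<in> {a..b}. \<gamma> u \<in> C y \<inter> P}" "Q \<noteq> {}"
          by (auto simp: \<U>_def)
        have "closedin mtopology (C y \<inter> P)"
          by (rule cpt_closed[OF CP_compact])
        moreover have "continuous_map (top_of_set {a..b}) mtopology \<gamma>"
          using cont abI by (metis continuous_map_from_subtopology_mono le_inf_iff)
        ultimately have "closedin (top_of_set {a..b}) Q"
          using Q closedin_continuous_map_preimage by fastforce
        then show "closed Q \<and> Q \<noteq> {}"
          using Q closedin_closed_trans by blast
      qed
      then have "{a..b} \<in> \<U>" by blast
      then obtain y where y: "{a..b} = {u \<in> {a..b}. \<gamma> u \<in> C y \<inter> P}"
        by (auto simp: \<U>_def)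
      then have "x \<in> C y" "\<gamma> s \<in> C y"
        using ab by (auto simp: x_def)
      then show ?thesis
        using C_eq[OF \<open>x \<in> C y\<close>] P[OF ab(2)] by simp
    qed
    \<comment> \<open>This turns the \<open>T\<close>-open condition \<open>V\<close> into a metric
      one: within \<open>C x \<inter> P\<close>, lying in \<open>V\<close> means avoiding a compact
      set that is closed for the metric, and \<gamma> does so on a relatively open set.\<close>
    have "compactin T (C x \<inter> P - V)"
      using closed_compactin[OF CP_compact] V CP_compact haus
      by (meson Diff_subset closedin_diff compactin_imp_closedin)
    then have "closedin mtopology (C x \<inter> P - V)"
      by (rule cpt_closed)
    then have "openin mtopology (M - (C x \<inter> P - V))"
      by (simp add: closedin_def)
    from openin_continuous_map_preimage[OF cont this]
    have "openin (top_of_set I) {s \<in> I. \<gamma> s \<in> M - (C x \<inter> P - V)}"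
      by (simp only: topspace_euclidean_subtopology)
    then have "openin (top_of_set I) ((ball t e \<inter> I) \<inter> {s \<in> I. \<gamma> s \<in> M - (C x \<inter> P - V)})"
      by (metis openin_Int openin_open_Int open_ball inf_commute)
    moreover have "t \<in> (ball t e \<inter> I) \<inter> {s \<in> I. \<gamma> s \<in> M - (C x \<inter> P - V)}"
      using t e \<gamma>M by auto
    ultimately show ?thesis
      using stay by (intro exI conjI) auto
  qed
  show ?thesis
    unfolding continuous_map_def
  proof (intro conjI allI impI)
    show "\<gamma> \<in> topspace (top_of_set I) \<rightarrow> topspace T"
      using \<gamma>M by (simp add: top)
    fix V assume V: "openin T V"
    show "openin (top_of_set I) {s \<in> topspace (top_of_set I). \<gamma> s \<in> V}"
      using local[OF V] by (subst openin_subopen) simp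
  qed
qed


section \<open>The quotient topology on the coset space\<close>

lemma (in group_action) subgroup_isotropy_subgroup:
  assumes "X \<subseteq> E"
  shows "subgroup (isotropy_subgroup G \<phi> X) G"
proof -
  interpret group G
    using group_hom by (simp add: group_hom_def)
  have comp: "\<phi> (a \<otimes> b) ` X = \<phi> a ` \<phi> b ` X" if "a \<in> carrier G" "b \<in> carrier G" for a b
    using that assms composition_rule by (force simp: image_image)
  have one: "\<phi> \<one> ` X = X"
  proof -
    have "\<phi> \<one> ` X = (\<lambda>x. x) ` X"
      using assms by (intro image_cong) (auto simp flip: id_eq_one)
    then show ?thesis by simp
  qed
  have "\<phi> (inv a) ` X = X" if "a \<in> carrier G" "\<phi> a ` X = X" for a
    using comp[of "inv a" a] one that by simp
  then show ?thesis
    by (unfold_locales) (auto simp: isotropy_subgroup_def comp one)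
qed

context lie_group
begin

lemma continuous_map_mult_left:
  assumes "g \<in> carrier G"
  shows "continuous_map T T (\<lambda>h. g \<otimes> h)"
proof -
  have "continuous_map (prod_topology T T) T (\<lambda>(g, h). g \<otimes> h)"
    using smooth_mult by (simp add: smooth_map_def)
  moreover have "continuous_map T (prod_topology T T) (\<lambda>h. (g, h))"
    using assms by (auto simp: continuous_map_pairwise o_def topspace_eq_carrier)
  ultimately have "continuous_map T T ((\<lambda>(g, h). g \<otimes> h) \<circ> (\<lambda>h. (g, h)))"
    by (rule continuous_map_compose[rotated])
  then show ?thesis
    by (simp add: o_def)
qed

lemma continuous_map_mult_right:
  assumes "g \<in> carrier G"
  shows "continuous_map T T (\<lambda>h. h \<otimes> g)"
proof -
  have "continuous_map (prod_topology T T) T (\<lambda>(g, h). g \<otimes> h)"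
    using smooth_mult by (simp add: smooth_map_def)
  moreover have "continuous_map T (prod_topology T T) (\<lambda>h. (h, g))"
    using assms by (auto simp: continuous_map_pairwise o_def topspace_eq_carrier)
  ultimately have "continuous_map T T ((\<lambda>(g, h). g \<otimes> h) \<circ> (\<lambda>h. (h, g)))"
    by (rule continuous_map_compose[rotated])
  then show ?thesis
    by (simp add: o_def)
qed

lemma topspace_quotient_lcosets: "topspace (quotient_topology T (\<lambda>g. g <#\<^bsub>G\<^esub> H)) = lcosets H"
  using quotient_imp_surjective_map[OF quotient_map_quotient_topology[of T "\<lambda>g. g <#\<^bsub>G\<^esub> H"]]
  by (auto simp: LCOSETS_def topspace_eq_carrier)

text \<open>The saturation of an open set \<open>U\<close> is the union, over
  \<open>h \<in> H\<close>, of the preimages of \<open>U\<close> under right multiplication by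
  \<open>h\<close>, each of which is open.\<close>

lemma open_map_lcosets:
  assumes "subgroup H G"
  shows "open_map T (quotient_topology T (\<lambda>g. g <#\<^bsub>G\<^esub> H)) (\<lambda>g. g <#\<^bsub>G\<^esub> H)"
  unfolding open_map_def
proof (intro allI impI)
  interpret subgroup H G by fact
  fix U assume U: "openin T U"
  then have UG: "U \<subseteq> carrier G"
    using openin_subset topspace_eq_carrier by blast
  have absorb: "h <#\<^bsub>G\<^esub> H = H" if "h \<in> H" for h
    using that coset_join3 subset assms by blast
  have "{g \<in> carrier G. g <#\<^bsub>G\<^esub> H \<in> (\<lambda>g. g <#\<^bsub>G\<^esub> H) ` U} = (\<Union>h\<in>H. {g \<in> carrier G. g \<otimes> h \<in> U})"
  proof (intro equalityI subsetI)
    fix g assume "g \<in> {g \<in> carrier G. g <#\<^bsub>G\<^esub> H \<in> (\<lambda>g. g <#\<^bsub>G\<^esub> H) ` U}"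
    then obtain u where u: "g \<in> carrier G" "u \<in> U" "g <#\<^bsub>G\<^esub> H = u <#\<^bsub>G\<^esub> H"
      by auto
    then have "u \<in> g <#\<^bsub>G\<^esub> H"
      using lcos_self[of u H] UG assms by auto
    then show "g \<in> (\<Union>h\<in>H. {g \<in> carrier G. g \<otimes> h \<in> U})"
      using u by (auto simp: l_coset_def)
  next
    fix g assume "g \<in> (\<Union>h\<in>H. {g \<in> carrier G. g \<otimes> h \<in> U})"
    then obtain h where h: "g \<in> carrier G" "h \<in> H" "g \<otimes> h \<in> U"
      by auto
    have "(g \<otimes> h) <#\<^bsub>G\<^esub> H = g <#\<^bsub>G\<^esub> H"
      using lcos_m_assoc[OF subset h(1), of h] h absorb by auto
    then show "g \<in> {g \<in> carrier G. g <#\<^bsub>G\<^esub> H \<in> (\<lambda>g. g <#\<^bsub>G\<^esub> H) ` U}"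
      using h by blast
  qed
  moreover have "openin T {g \<in> carrier G. g \<otimes> h \<in> U}" if "h \<in> H" for h
    using openin_continuous_map_preimage[OF continuous_map_mult_right U, of h] that
    by (simp add: topspace_eq_carrier)
  ultimately have "openin T {g \<in> carrier G. g <#\<^bsub>G\<^esub> H \<in> (\<lambda>g. g <#\<^bsub>G\<^esub> H) ` U}"
    by (auto intro!: openin_Union)
  then show "openin (quotient_topology T (\<lambda>g. g <#\<^bsub>G\<^esub> H)) ((\<lambda>g. g <#\<^bsub>G\<^esub> H) ` U)"
    using UG by (simp add: openin_quotient_topology topspace_eq_carrier image_mono)
qed

text \<open>Left multiplication commutes with the projection to cosets, so its continuity descends
  along the quotient map.\<close>

lemma continuous_map_lcoset_translation:
  assumes "subgroup H G" and g: "g \<in> carrier G"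
  shows "continuous_map (quotient_topology T (\<lambda>g. g <#\<^bsub>G\<^esub> H)) (quotient_topology T (\<lambda>g. g <#\<^bsub>G\<^esub> H))
    (\<lambda>C. g <#\<^bsub>G\<^esub> C)"
proof (rule continuous_compose_quotient_map[OF quotient_map_quotient_topology])
  interpret subgroup H G by fact
  let ?q = "\<lambda>g. g <#\<^bsub>G\<^esub> H"
  have "continuous_map T (quotient_topology T ?q) (?q \<circ> (\<lambda>h. g \<otimes> h))"
    using continuous_map_mult_left[OF g] quotient_imp_continuous_map[OF quotient_map_quotient_topology]
    by (rule continuous_map_compose)
  then show "continuous_map T (quotient_topology T ?q) ((\<lambda>C. g <#\<^bsub>G\<^esub> C) \<circ> ?q)"
    by (rule continuous_map_eq) (simp add: topspace_eq_carrier lcos_m_assoc subset g)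
qed

end

section \<open>Comparison of the quotient topology with the induced Hausdorff metric\<close>

text \<open>By compactness of \<open>X\<close>, group elements near the identity move all points of
  \<open>X\<close> uniformly little. Nearby elements of the group thus give translates of
  \<open>X\<close> that are close in the Hausdorff distance, so the quotient topology is finer than
  that of \<open>d\<^sub>X\<close>.\<close>

lemma openin_quotient_if_openin_coset_dist:
  fixes G :: "('g, 'r) monoid_scheme" (structure)
  assumes "lie_group G T A" and "Metric_space M d"
    and "X \<noteq> {}" and X: "compactin (Metric_space.mtopology M d) X"
    and act: "group_action G M \<phi>"
    and cont: "continuous_map (prod_topology T (Metric_space.mtopology M d))
      (Metric_space.mtopology M d) (\<lambda>(g, x). \<phi> g x)"
    and iso: "\<And>g x y. g \<in> carrier G \<Longrightarrow> x \<in> M \<Longrightarrow> y \<in> M \<Longrightarrow> d (\<phi> g x) (\<phi> g y) = d x y"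
  defines "H \<equiv> isotropy_subgroup G \<phi> X"
  assumes U: "openin (Metric_space.mtopology (lcosets H) (coset_dist G \<phi> d X)) U"
  shows "openin (quotient_topology T (\<lambda>g. g <#\<^bsub>G\<^esub> H)) U"
proof -
  interpret lie_group G T A by fact
  interpret Metric_space M d by fact
  interpret act: group_action G M \<phi> by fact
  have XM: "X \<subseteq> M"
    using X compactin_subset_topspace by fastforce
  interpret Y: Metric_space "lcosets H" "coset_dist G \<phi> d X"
    unfolding H_def
    by (rule Metric_space_coset_dist[OF act \<open>Metric_space M d\<close> \<open>X \<noteq> {}\<close> X]) (rule iso)
  have UY: "U \<subseteq> lcosets H"
    using openin_subset[OF U] by simp
  have "openin T {g \<in> carrier G. g <#\<^bsub>G\<^esub> H \<in> U}"
  proof (subst openin_subopen, intro ballI)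
    fix g assume "g \<in> {g \<in> carrier G. g <#\<^bsub>G\<^esub> H \<in> U}"
    then have g: "g \<in> carrier G" "g <#\<^bsub>G\<^esub> H \<in> U" by auto
    then obtain e where e: "e > 0" "Y.mball (g <#\<^bsub>G\<^esub> H) e \<subseteq> U"
      using U unfolding Y.openin_mtopology by blast
    have "continuous_map (prod_topology T mtopology) euclideanreal (\<lambda>p. d (snd p) ((\<lambda>(k, x). \<phi> k x) p))"
      using continuous_map_mdist[of _ "metric (M, d)", simplified, OF continuous_map_snd cont] .
    from openin_continuous_map_preimage[OF this, of "{..<e/2}"]
    have W: "openin (prod_topology T mtopology)
        {p \<in> carrier G \<times> M. d (snd p) ((\<lambda>(k, x). \<phi> k x) p) < e/2}"
      by (simp add: topspace_eq_carrier)
    \<comment> \<open>The identity displaces no point, so the tube lemma thickens this slice to a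
      product on which displacements stay below \<open>e/2\<close>. The half leaves room for
      suprema, which preserve only weak inequalities.\<close>
    have "{\<one>} \<times> X \<subseteq> {p \<in> carrier G \<times> M. d (snd p) ((\<lambda>(k, x). \<phi> k x) p) < e/2}"
      using XM e(1) by (auto simp flip: act.id_eq_one)
    then obtain N V where N: "openin T N" "\<one> \<in> N" and NV: "X \<subseteq> V"
      "N \<times> V \<subseteq> {p \<in> carrier G \<times> M. d (snd p) ((\<lambda>(k, x). \<phi> k x) p) < e/2}"
      using tube_lemma_right[OF W X, of \<one>] by (auto simp: topspace_eq_carrier)
    have small: "d x (\<phi> k x) < e/2" if "k \<in> N" "x \<in> X" for k x
      using subsetD[OF NV(2), of "(k, x)"] NV(1) that by auto
    let ?N = "{h \<in> carrier G. inv g \<otimes> h \<in> N}"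
    have "openin T ?N"
      using openin_continuous_map_preimage[OF continuous_map_mult_left N(1), of "inv g"] g
      by (simp add: topspace_eq_carrier)
    moreover have "g \<in> ?N"
      using g N by simp
    moreover have "h <#\<^bsub>G\<^esub> H \<in> U" if h: "h \<in> ?N" for h
    proof -
      \<comment> \<open>As \<open>\<phi> g\<close> is an isometry, this distance is the displacement
        of \<open>x\<close> by \<open>inv g \<otimes> h\<close>, an element of
        \<open>N\<close>.\<close>
      have disp: "d (\<phi> g x) (\<phi> h x) \<le> e/2" if "x \<in> X" for x
      proof -
        have xM: "x \<in> M" "\<phi> (inv g \<otimes> h) x \<in> M"
          using that XM act.element_image[of "inv g \<otimes> h"] g h by auto
        have "\<phi> h x = \<phi> g (\<phi> (inv g \<otimes> h) x)"
          using g h xM act.composition_rule[of x g "inv g \<otimes> h"] by (simp flip: m_assoc)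
        then have "d (\<phi> g x) (\<phi> h x) = d x (\<phi> (inv g \<otimes> h) x)"
          using g xM iso by simp
        then show ?thesis
          using small[of "inv g \<otimes> h" x] h that by simp
      qed
      have bdd: "bdd_below (d a ` B)" for a B
        by (rule bdd_belowI[of _ 0]) auto
      have "coset_dist G \<phi> d X (g <#\<^bsub>G\<^esub> H) (h <#\<^bsub>G\<^esub> H) = Hausdorff_dist d (\<phi> g ` X) (\<phi> h ` X)"
        unfolding H_def using coset_dist_l_coset[OF act XM] g h by simp
      also have "\<dots> \<le> e/2"
      proof (rule Hausdorff_dist_le)
        fix a assume "a \<in> \<phi> g ` X"
        then obtain x where x: "x \<in> X" "a = \<phi> g x" by blast
        show "(INF b\<in>\<phi> h ` X. d a b) \<le> e/2"
          using cINF_lower2[OF bdd, of "\<phi> h x" "\<phi> h ` X" a "e/2"] x disp by auto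
      next
        fix a assume "a \<in> \<phi> h ` X"
        then obtain x where x: "x \<in> X" "a = \<phi> h x" by blast
        show "(INF b\<in>\<phi> g ` X. d a b) \<le> e/2"
          using cINF_lower2[OF bdd, of "\<phi> g x" "\<phi> g ` X" a "e/2"] x disp commute[of a] by auto
      qed (use \<open>X \<noteq> {}\<close> in auto)
      finally have "coset_dist G \<phi> d X (g <#\<^bsub>G\<^esub> H) (h <#\<^bsub>G\<^esub> H) < e"
        using e(1) by simp
      moreover have "g <#\<^bsub>G\<^esub> H \<in> lcosets H" "h <#\<^bsub>G\<^esub> H \<in> lcosets H"
        using g h by (auto simp: LCOSETS_def)
      ultimately have "h <#\<^bsub>G\<^esub> H \<in> Y.mball (g <#\<^bsub>G\<^esub> H) e"
        by simp
      then show ?thesis using e by blast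
    qed
    ultimately show "\<exists>N. openin T N \<and> g \<in> N \<and> N \<subseteq> {g \<in> carrier G. g <#\<^bsub>G\<^esub> H \<in> U}"
      by (intro exI[of _ ?N]) blast
  qed
  moreover have "U \<subseteq> (\<lambda>g. g <#\<^bsub>G\<^esub> H) ` carrier G"
    using UY by (auto simp: LCOSETS_def)
  ultimately show ?thesis
    by (simp add: openin_quotient_topology topspace_eq_carrier)
qed

section \<open>Application to the coset space of the isotropy group\<close>

theorem theorem6p10:
  fixes G :: "('g, 'r) monoid_scheme" (structure)
    and T\<^sub>G :: "'g topology" and A\<^sub>G :: "('g, 'e::real_normed_vector) chart set"
    and T\<^sub>M :: "'m topology" and A\<^sub>M :: "('m, 'f::real_normed_vector) chart set"
    and d :: "'m \<Rightarrow> 'm \<Rightarrow> real" and X :: "'m set"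
    and \<phi> :: "'g \<Rightarrow> 'm \<Rightarrow> 'm"
    and I :: "real set" and \<gamma> :: "real \<Rightarrow> 'g set"
  defines "H \<equiv> isotropy_subgroup G \<phi> X"
  assumes "lie_group G T\<^sub>G A\<^sub>G"
    and "smooth_manifold T\<^sub>M A\<^sub>M"
    and "Metric_space (topspace T\<^sub>M) d"
    and "Metric_space.mtopology (topspace T\<^sub>M) d = T\<^sub>M"
    and "X \<noteq> {}" and "compactin T\<^sub>M X"
    and "group_action G (topspace T\<^sub>M) \<phi>"
    and "smooth_map (prod_topology T\<^sub>G T\<^sub>M) (prod_atlas A\<^sub>G A\<^sub>M) T\<^sub>M A\<^sub>M (\<lambda>(g, x). \<phi> g x)"
    and "\<And>g x y. g \<in> carrier G \<Longrightarrow> x \<in> topspace T\<^sub>M \<Longrightarrow> y \<in> topspace T\<^sub>M \<Longrightarrow>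
           d (\<phi> g x) (\<phi> g y) = d x y"
    and "is_interval I"
    and "continuous_map (top_of_set I)
           (Metric_space.mtopology (lcosets H) (coset_dist G \<phi> d X)) \<gamma>"
  shows "continuous_map (top_of_set I) (quotient_topology T\<^sub>G (\<lambda>g. g <# H)) \<gamma>"
proof -
  interpret G: lie_group G T\<^sub>G A\<^sub>G by fact
  interpret M: Metric_space "topspace T\<^sub>M" d by fact
  interpret act: group_action G "topspace T\<^sub>M" \<phi> by fact
  note TM = \<open>M.mtopology = T\<^sub>M\<close>
  note iso = assms(10)
  have X: "X \<subseteq> topspace T\<^sub>M" "compactin M.mtopology X"
    using \<open>compactin T\<^sub>M X\<close> compactin_subset_topspace TM by auto
  interpret Y: Metric_space "lcosets H" "coset_dist G \<phi> d X"
    unfolding H_def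
    by (rule Metric_space_coset_dist[OF act.group_action_axioms M.Metric_space_axioms \<open>X \<noteq> {}\<close> X(2)])
      (rule iso)
  have H: "subgroup H G"
    unfolding H_def using X(1) by (rule act.subgroup_isotropy_subgroup)
  interpret H: subgroup H G by (rule H)
  define q where "q = (\<lambda>g. g <#\<^bsub>G\<^esub> H)"
  define Q where "Q = quotient_topology T\<^sub>G q"
  have quot: "quotient_map T\<^sub>G Q q"
    unfolding Q_def by (rule quotient_map_quotient_topology)
  have topQ: "topspace Q = lcosets H"
    unfolding Q_def q_def by (rule G.topspace_quotient_lcosets)
  have finer: "openin Q U" if "openin Y.mtopology U" for U
  proof -
    have "continuous_map (prod_topology T\<^sub>G M.mtopology) M.mtopology (\<lambda>(g, x). \<phi> g x)"
      using assms(9) by (simp add: smooth_map_def TM)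
    note finer = openin_quotient_if_openin_coset_dist[OF G.lie_group_axioms M.Metric_space_axioms
        \<open>X \<noteq> {}\<close> X(2) act.group_action_axioms this, folded H_def]
    show ?thesis
      unfolding Q_def q_def by (rule finer) (use iso that in auto)
  qed
  have q_mem: "q g \<in> lcosets H" if "g \<in> carrier G" for g
    using that by (auto simp: q_def LCOSETS_def)
  have q_mult: "g <#\<^bsub>G\<^esub> q h = q (g \<otimes> h)" if "g \<in> carrier G" "h \<in> carrier G" for g h
    using that G.lcos_m_assoc[OF H.subset] by (simp add: q_def)
  have trans_inv: "inv g <#\<^bsub>G\<^esub> (g <#\<^bsub>G\<^esub> C) = C" "g <#\<^bsub>G\<^esub> (inv g <#\<^bsub>G\<^esub> C) = C"
    "g <#\<^bsub>G\<^esub> C \<in> lcosets H" if g: "g \<in> carrier G" and C: "C \<in> lcosets H" for g C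
  proof -
    obtain h where "h \<in> carrier G" "C = q h"
      using C by (auto simp: LCOSETS_def q_def)
    then show "inv g <#\<^bsub>G\<^esub> (g <#\<^bsub>G\<^esub> C) = C" "g <#\<^bsub>G\<^esub> (inv g <#\<^bsub>G\<^esub> C) = C"
      "g <#\<^bsub>G\<^esub> C \<in> lcosets H"
      using g by (simp_all add: q_mult q_mem flip: G.m_assoc)
  qed
  \<comment> \<open>Translating both cosets by \<open>g\<close> applies the isometry
    \<open>\<phi> g\<close> to both translates of \<open>X\<close>, which leaves every distance in
    the Hausdorff formula unchanged.\<close>
  have trans_iso: "coset_dist G \<phi> d X (g <#\<^bsub>G\<^esub> C) (g <#\<^bsub>G\<^esub> D) = coset_dist G \<phi> d X C D"
    if g: "g \<in> carrier G" and CD: "C \<in> lcosets H" "D \<in> lcosets H" for g C D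
  proof -
    obtain h k where hk: "h \<in> carrier G" "C = q h" "k \<in> carrier G" "D = q k"
      using CD by (auto simp: LCOSETS_def q_def)
    have img: "\<phi> (g \<otimes> a) ` X = \<phi> g ` \<phi> a ` X" if "a \<in> carrier G" for a
      unfolding image_image using X(1) g that by (intro image_cong refl act.composition_rule) auto
    have sub: "\<phi> a ` X \<subseteq> topspace T\<^sub>M" if "a \<in> carrier G" for a
      using image_mono[OF X(1), of "\<phi> a"] act.surj_prop[OF that] by simp
    have "Hausdorff_dist d (\<phi> g ` A) (\<phi> g ` B) = Hausdorff_dist d A B"
      if "A \<subseteq> topspace T\<^sub>M" "B \<subseteq> topspace T\<^sub>M" for A B
    proof -
      have "d (\<phi> g a) (\<phi> g b) = d a b" "d (\<phi> g b) (\<phi> g a) = d b a" if "a \<in> A" "b \<in> B" for a b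
        using that \<open>A \<subseteq> topspace T\<^sub>M\<close> \<open>B \<subseteq> topspace T\<^sub>M\<close> by (auto intro!: iso g)
      then show ?thesis
        by (simp add: Hausdorff_dist_def image_image cong: image_cong)
    qed
    then have "Hausdorff_dist d (\<phi> (g \<otimes> h) ` X) (\<phi> (g \<otimes> k) ` X) = Hausdorff_dist d (\<phi> h ` X) (\<phi> k ` X)"
      by (simp only: img sub hk)
    moreover have "coset_dist G \<phi> d X (q a) (q b) = Hausdorff_dist d (\<phi> a ` X) (\<phi> b ` X)"
      if "a \<in> carrier G" "b \<in> carrier G" for a b
      unfolding q_def H_def by (rule coset_dist_l_coset[OF act.group_action_axioms X(1) that])
    ultimately show ?thesis
      using g hk by (simp add: q_mult)
  qed
  obtain U K where U: "openin T\<^sub>G U" "\<one> \<in> U" "U \<subseteq> K" and K: "compactin T\<^sub>G K"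
    using G.compact_connected_neighbourhood[OF openin_topspace, of "\<one>"]
    by (metis G.one_closed G.topspace_eq_carrier)
  have qU: "openin Q (q ` U)"
    using G.open_map_lcosets[OF H] U(1) by (simp add: open_map_def Q_def q_def)
  have qK: "compactin Q (q ` K)"
    using K quot by (metis image_compactin quotient_imp_continuous_map)
  obtain \<delta> where \<delta>: "\<delta> > 0" "Y.mball (q \<one>) \<delta> \<inter> q ` K \<subseteq> q ` U"
  proof -
    have "Hausdorff_space Q"
      using topQ finer by (rule Y.finer_Hausdorff)
    \<comment> \<open>The shell is compact for the quotient topology, hence closed for the metric,
      and it misses the base point; \<delta> is the radius of a ball around the base point disjoint
      from it.\<close>
    then have "compactin Q (q ` K - q ` U)"
      using qU qK by (meson Diff_subset closed_compactin closedin_diff compactin_imp_closedin)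
    then have "closedin Y.mtopology (q ` K - q ` U)"
      using Y.finer_compactin_imp_closedin[OF topQ finer] by blast
    moreover have "q \<one> \<in> lcosets H - (q ` K - q ` U)"
      using U q_mem by auto
    ultimately obtain \<delta> where "\<delta> > 0" "disjnt (q ` K - q ` U) (Y.mball (q \<one>) \<delta>)"
      unfolding Y.closedin_metric by blast
    then show ?thesis
      by (intro that[of \<delta>]) (auto simp only: disjnt_iff)
  qed
  have nbhd: "\<exists>V L. openin Q V \<and> compactin Q L \<and> C \<in> V \<and> V \<subseteq> L \<and> Y.mball C \<delta> \<inter> L \<subseteq> V"
    if C: "C \<in> lcosets H" for C
  proof -
    obtain g where g: "g \<in> carrier G" "C = q g"
      using C by (auto simp: LCOSETS_def q_def)
    have trans_cont: "continuous_map Q Q (\<lambda>D. h <#\<^bsub>G\<^esub> D)" if "h \<in> carrier G" for h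
      unfolding Q_def q_def using H that by (rule G.continuous_map_lcoset_translation)
    \<comment> \<open>Both sets are translates by \<open>g\<close> of the sets at the base point.
      \<open>?V\<close> is written as a preimage under the inverse translation and \<open>?L\<close>
      as an image, so that continuity of translations yields openness of one and compactness of the
      other.\<close>
    let ?V = "{D \<in> lcosets H. inv g <#\<^bsub>G\<^esub> D \<in> q ` U}" and ?L = "(\<lambda>D. g <#\<^bsub>G\<^esub> D) ` q ` K"
    have KL: "q ` K \<subseteq> lcosets H"
      using qK compactin_subset_topspace topQ by blast
    have "openin Q ?V"
      using openin_continuous_map_preimage[OF trans_cont qU, of "inv g"] g by (simp add: topQ)
    moreover have "compactin Q ?L"
      using g by (intro image_compactin[OF qK] trans_cont)
    moreover have "C \<in> ?V"
      using g U q_mem by (simp add: q_mult)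
    moreover have "?V \<subseteq> ?L"
    proof
      fix D assume "D \<in> ?V"
      then have "inv g <#\<^bsub>G\<^esub> D \<in> q ` K" "g <#\<^bsub>G\<^esub> (inv g <#\<^bsub>G\<^esub> D) = D"
        using U(3) trans_inv(2)[OF g(1)] by auto
      then show "D \<in> ?L" by (metis image_eqI)
    qed
    moreover have "Y.mball C \<delta> \<inter> ?L \<subseteq> ?V"
    proof
      fix D assume D: "D \<in> Y.mball C \<delta> \<inter> ?L"
      then obtain E where E: "E \<in> q ` K" "D = g <#\<^bsub>G\<^esub> E" by blast
      then have EH: "E \<in> lcosets H" using KL by blast
      have "C = g <#\<^bsub>G\<^esub> q \<one>"
        using g by (simp add: q_mult)
      \<comment> \<open>Since \<open>C\<close> and \<open>D\<close> arise from the base point and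
        \<open>E\<close> by the same translation, \<open>trans_iso\<close> brings the comparison
        back to the base point, where \<delta> was chosen.\<close>
      then have "E \<in> Y.mball (q \<one>) \<delta>"
        using D E EH trans_iso[OF g(1) q_mem[OF G.one_closed] EH] q_mem[OF G.one_closed] by simp
      then have "E \<in> q ` U"
        using \<delta> E by blast
      then show "D \<in> ?V"
        using E EH trans_inv[OF g(1) EH] by simp
    qed
    ultimately show ?thesis by blast
  qed
  have "continuous_map (top_of_set I) Q \<gamma>"
  proof (rule Y.continuous_map_interval_finer_topology[OF topQ finer _ _ \<delta>(1) nbhd \<open>is_interval I\<close>])
    \<comment> \<open>Local connectedness and separability both pass from the group to its quotient;
      the latter comes from the countable basis.\<close>
    show "locally_connected_space Q"
      using G.locally_connected quot by (rule locally_connected_space_quotient_map_image)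
    show "separable_space Q"
      using separable_space_quotient_map_image[OF quot]
        second_countable_imp_separable_space[OF G.countable_basis] by blast
  qed (use assms(12) in auto)
  then show ?thesis
    by (simp add: Q_def q_def)
qed

end
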